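(* Let $\Xi$ be the improper prior on $\mathbb R^n$ defined below, with $\pi_n(t)=e^{-dt\log p}/\sum_{u=0}^ne^{-du\log p}$, $t=0,\dots,n$, for a fixed $d\ge4$. Then for $M$ large enough, \[ \sup_{\beta^0\in\mathbb R^p}\mathbb E_{\beta^0}\,\Xi\big[\gamma\in\mathbb R^n:\|\gamma-X\beta^0\|_2^2>M(t_0\vee1)\log p\ \big|\ Y\big]\to0 \] as $n,p\to\infty$, where $t_0$ is the dimension of $V^0=\{X\beta:S_\beta\subseteq S_{\beta^0}\}$.
   Context: Observations follow $Y=X\beta+\varepsilon$ with $X$ a deterministic real $n\times p$ matrix and $\varepsilon\sim N_n(0,I_n)$; $\mathbb E_{\beta^0}$ is expectation when $Y\sim N_n(X\beta^0,I_n)$; $S_\beta=\{i:\beta_i\ne0\}$. For $S\subset\{1,\dots,p\}$ let $\mathcal Y_S=\{X\beta:S_\beta\subseteq S\}$ (span of columns of $X$ indexed by $S$), and let $\mathcal V$ be the collection of all distinct subspaces $\mathcal Y_S$. The prior $\Xi$: select $t\in\{0,\dots,n\}$ according to $\pi_n$; given $t$, select $V\in\mathcal V$ of dimension $t$ uniformly at random among elements of $\mathcal V$ of dimension $t$; given $V$, $\Xi$ is Lebesgue measure on $V$ if $\dim V\ge1$ and the Dirac mass at $0$ if $V=\{0\}$. The posterior is the probability measure $\Xi[B\mid Y]=\int_Be^{-\|Y-\gamma\|_2^2/2}d\Xi(\gamma)/\int e^{-\|Y-\gamma\|_2^2/2}d\Xi(\gamma)$. Asymptotics: $n,p\to\infty$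 with $X$ depending on $n,p$ and $d$ fixed. *)

theory Defs
  imports "HOL-Probability.Probability" "HOL-Library.Function_Algebras"
begin

text \<open>Vectors of R^n are represented as functions nat => real vanishing outside {..<n};
  the n x p design matrix X is a function of (n, p, i, j), entries X n p i j for i<n, j<p.\<close>

abbreviation vscale :: "real \<Rightarrow> (nat \<Rightarrow> real) \<Rightarrow> (nat \<Rightarrow> real)" where
  "vscale \<equiv> (\<lambda>c f i. c * f i)"

abbreviation vdim :: "(nat \<Rightarrow> real) set \<Rightarrow> nat" where
  "vdim V \<equiv> vector_space.dim vscale V"

definition sqnorm :: "nat \<Rightarrow> (nat \<Rightarrow> real) \<Rightarrow> real" where
  "sqnorm n v = (\<Sum>i<n. (v i)\<^sup>2)"

definition inner_n :: "nat \<Rightarrow> (nat \<Rightarrow> real) \<Rightarrow> (nat \<Rightarrow> real) \<Rightarrow> real" where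
  "inner_n n u v = (\<Sum>i<n. u i * v i)"

definition Xmul :: "(nat \<Rightarrow> nat \<Rightarrow> nat \<Rightarrow> nat \<Rightarrow> real) \<Rightarrow> nat \<Rightarrow> nat \<Rightarrow> (nat \<Rightarrow> real) \<Rightarrow> (nat \<Rightarrow> real)" where
  "Xmul X n p \<beta> = (\<lambda>i. if i < n then (\<Sum>j<p. X n p i j * \<beta> j) else 0)"

definition colspace :: "(nat \<Rightarrow> nat \<Rightarrow> nat \<Rightarrow> nat \<Rightarrow> real) \<Rightarrow> nat \<Rightarrow> nat \<Rightarrow> nat set \<Rightarrow> (nat \<Rightarrow> real) set" where
  "colspace X n p S = {Xmul X n p \<beta> | \<beta>. (\<forall>j<p. \<beta> j = 0 \<or> j \<in> S) \<and> (\<forall>j\<ge>p. \<beta> j = 0)}"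

definition Vcoll :: "(nat \<Rightarrow> nat \<Rightarrow> nat \<Rightarrow> nat \<Rightarrow> real) \<Rightarrow> nat \<Rightarrow> nat \<Rightarrow> (nat \<Rightarrow> real) set set" where
  "Vcoll X n p = {colspace X n p S | S. S \<subseteq> {..<p}}"

definition onb :: "nat \<Rightarrow> (nat \<Rightarrow> real) set \<Rightarrow> nat \<Rightarrow> (nat \<Rightarrow> real)" where
  "onb n V = (SOME b. (\<forall>j<vdim V. b j \<in> V) \<and>
                      (\<forall>j<vdim V. \<forall>l<vdim V. inner_n n (b j) (b l) = (if j = l then 1 else 0)))"

definition embed :: "nat \<Rightarrow> (nat \<Rightarrow> (nat \<Rightarrow> real)) \<Rightarrow> nat \<Rightarrow> (nat \<Rightarrow> real) \<Rightarrow> (nat \<Rightarrow> real)" where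
  "embed n b t c = (\<lambda>i. if i < n then (\<Sum>j<t. c j * b j i) else 0)"

text \<open>Integral of f over V w.r.t. Lebesgue measure on V (image of Lebesgue measure on R^t,
  t = dim V, under an isometric parametrisation); Dirac mass at 0 if V = {0}.\<close>
definition lebV_int :: "nat \<Rightarrow> (nat \<Rightarrow> real) set \<Rightarrow> ((nat \<Rightarrow> real) \<Rightarrow> real) \<Rightarrow> real" where
  "lebV_int n V f = (if vdim V = 0 then f (\<lambda>_. 0)
     else (\<integral>c. f (embed n (onb n V) (vdim V) c) \<partial>(Pi\<^sub>M {..<vdim V} (\<lambda>_. lborel))))"

definition pi_n :: "real \<Rightarrow> nat \<Rightarrow> nat \<Rightarrow> nat \<Rightarrow> real" where
  "pi_n d n p t = exp (- d * real t * ln (real p)) / (\<Sum>u\<le>n. exp (- d * real u * ln (real p)))"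

definition Xi_int :: "real \<Rightarrow> (nat \<Rightarrow> nat \<Rightarrow> nat \<Rightarrow> nat \<Rightarrow> real) \<Rightarrow> nat \<Rightarrow> nat \<Rightarrow> ((nat \<Rightarrow> real) \<Rightarrow> real) \<Rightarrow> real" where
  "Xi_int d X n p f = (\<Sum>t\<le>n. pi_n d n p t / real (card {V \<in> Vcoll X n p. vdim V = t}) *
       (\<Sum>V \<in> {V \<in> Vcoll X n p. vdim V = t}. lebV_int n V f))"

definition posterior :: "real \<Rightarrow> (nat \<Rightarrow> nat \<Rightarrow> nat \<Rightarrow> nat \<Rightarrow> real) \<Rightarrow> nat \<Rightarrow> nat \<Rightarrow> ((nat \<Rightarrow> real) \<Rightarrow> bool) \<Rightarrow> (nat \<Rightarrow> real) \<Rightarrow> real" where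
  "posterior d X n p P Y =
     Xi_int d X n p (\<lambda>\<gamma>. (if P \<gamma> then 1 else 0) * exp (- sqnorm n (\<lambda>i. Y i - \<gamma> i) / 2)) /
     Xi_int d X n p (\<lambda>\<gamma>. exp (- sqnorm n (\<lambda>i. Y i - \<gamma> i) / 2))"

definition gauss_n :: "nat \<Rightarrow> (nat \<Rightarrow> real) \<Rightarrow> (nat \<Rightarrow> real) measure" where
  "gauss_n n \<mu> = Pi\<^sub>M {..<n} (\<lambda>i. density lborel (normal_density (\<mu> i) 1))"

end

theory Submission
  imports Defs
begin

text \<open>
  Write \<open>\<mu> = X \<beta>0\<close>, \<open>e = Y - \<mu>\<close> and let \<open>B\<close> be the event \<open>|\<gamma> - \<mu>|^2 > R\<close>. The mass that a subspace \<open>V\<close>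
  contributes to the posterior of \<open>B\<close> is at most its ratio to the term of \<open>V0\<close> in the normalising
  constant, a term that is at least its prior weight times \<open>exp (- |e|^2 / 2)\<close>. For \<open>\<gamma>\<close> in \<open>V\<close> the vector
  \<open>h = \<gamma> - \<mu>\<close> lies in \<open>W = V + span \<mu>\<close>, so \<open>\<langle>e, h\<rangle> \<le> |P_W e|^2 + |h|^2 / 4\<close>; the remaining
  \<open>exp (- |h|^2 / 4)\<close> gives a factor \<open>exp (- R / 8)\<close> on \<open>B\<close> and a Gaussian integral over \<open>V\<close>. The ratio is
  thus a constant times \<open>exp (|P_W e|^2)\<close>, and as a mass is at most \<open>1\<close> it may be replaced by the
  fourth root, with expectation at most the fourth root of the constant times \<open>sqrt 2 ^ (dim V + 1)\<close>.
  At most \<open>p ^ t\<close> subspaces have dimension \<open>t\<close>, so for \<open>d \<ge> 4\<close> the sum of these bounds over all \<open>V\<close>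
  is dominated by a geometric series with total at most \<open>4 / p\<close>, uniformly in \<open>\<beta>0\<close>.
\<close>

subsection \<open>Orthonormal systems and column spaces\<close>

interpretation fv: vector_space vscale
  by unfold_locales (auto simp: fun_eq_iff algebra_simps)

lemma sum_fun_apply: "(\<Sum>j\<in>A. f j) i = (\<Sum>j\<in>A. f j i)"
  for f :: "'a \<Rightarrow> 'b \<Rightarrow> 'c::comm_monoid_add"
  by (induction A rule: infinite_finite_induct) auto

lemma inner_n_diff: "inner_n n (\<lambda>i. u i - v i) w = inner_n n u w - inner_n n v w"
  by (simp add: inner_n_def algebra_simps sum_subtractf)

lemma inner_n_scale: "inner_n n (\<lambda>i. c * u i) w = c * inner_n n u w"
  by (simp add: inner_n_def sum_distrib_left algebra_simps)

lemma inner_n_commute: "inner_n n u w = inner_n n w u"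
  by (simp add: inner_n_def mult.commute)

lemma inner_n_embed: "inner_n n v (embed n b t c) = (\<Sum>j<t. c j * inner_n n v (b j))"
proof -
  have "inner_n n v (embed n b t c) = (\<Sum>i<n. \<Sum>j<t. v i * (c j * b j i))"
    by (simp add: inner_n_def embed_def sum_distrib_left)
  also have "\<dots> = (\<Sum>j<t. \<Sum>i<n. v i * (c j * b j i))"
    by (rule sum.swap)
  finally show ?thesis
    by (simp add: inner_n_def sum_distrib_left mult_ac)
qed

lemma sqnorm_inner: "sqnorm n v = inner_n n v v"
  by (simp add: sqnorm_def inner_n_def power2_eq_square)

lemma sqnorm_nonneg: "sqnorm n v \<ge> 0"
  by (simp add: sqnorm_def sum_nonneg)

lemma sqnorm_diff:
  "sqnorm n (\<lambda>i. u i - v i) = sqnorm n u - 2 * inner_n n u v + sqnorm n v"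
  by (simp add: sqnorm_def inner_n_def power2_eq_square algebra_simps
      sum.distrib sum_subtractf sum_distrib_left)

lemma sqnorm_eq_0: "sqnorm n v = 0 \<longleftrightarrow> (\<forall>i<n. v i = 0)"
  by (auto simp: sqnorm_def sum_nonneg_eq_0_iff)

text \<open>Stated for orthogonal systems so that it covers \<open>extend\<close> as well, whose
  last vector may be 0.\<close>

lemma sqnorm_embed_orthogonal:
  assumes "\<And>j l. j < t \<Longrightarrow> l < t \<Longrightarrow> j \<noteq> l \<Longrightarrow> inner_n n (b j) (b l) = 0"
  shows "sqnorm n (embed n b t c) = (\<Sum>j<t. (c j)\<^sup>2 * sqnorm n (b j))"
proof -
  have "inner_n n (b j) (embed n b t c) = c j * sqnorm n (b j)" if "j < t" for j
  proof -
    have "inner_n n (b j) (embed n b t c) = (\<Sum>l<t. if l = j then c j * sqnorm n (b j) else 0)"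
      unfolding inner_n_embed using assms that by (intro sum.cong) (auto simp: sqnorm_inner)
    thus ?thesis using that by simp
  qed
  hence "(\<Sum>j<t. c j * inner_n n (embed n b t c) (b j)) = (\<Sum>j<t. c j * (c j * sqnorm n (b j)))"
    by (intro sum.cong) (auto simp: inner_n_commute[of n "embed n b t c"])
  thus ?thesis
    unfolding sqnorm_inner[of n "embed n b t c"] inner_n_embed
    by (simp add: power2_eq_square mult_ac)
qed

section \<open>Orthonormal systems and the Gram-Schmidt step\<close>

definition orthonormal :: "nat \<Rightarrow> (nat \<Rightarrow> nat \<Rightarrow> real) \<Rightarrow> nat \<Rightarrow> bool" where
  "orthonormal n b t \<longleftrightarrow> (\<forall>j<t. \<forall>l<t. inner_n n (b j) (b l) = (if j = l then 1 else 0))"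

lemma orthonormalD: "orthonormal n b t \<Longrightarrow> j < t \<Longrightarrow> l < t \<Longrightarrow> inner_n n (b j) (b l) = (if j = l then 1 else 0)"
  by (auto simp: orthonormal_def)

lemma sqnorm_embed:
  assumes "orthonormal n b t"
  shows "sqnorm n (embed n b t c) = (\<Sum>j<t. (c j)\<^sup>2)"
  using assms by (subst sqnorm_embed_orthogonal) (auto simp: orthonormal_def sqnorm_inner)

text \<open>Completing the square in each \<open>c j\<close>. The part free of \<open>c\<close> is
  the squared distance of \<open>v\<close> from the span of \<open>b\<close>, and the rest makes
  Gaussian integrals over \<open>c\<close> factorise.\<close>

lemma sqnorm_diff_embed:
  assumes "orthonormal n b t"
  shows "sqnorm n (\<lambda>i. v i - embed n b t c i) =
    sqnorm n v - (\<Sum>j<t. (inner_n n v (b j))\<^sup>2) + (\<Sum>j<t. (c j - inner_n n v (b j))\<^sup>2)"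
  unfolding sqnorm_diff sqnorm_embed[OF assms] inner_n_embed
  by (simp add: power2_eq_square algebra_simps sum.distrib sum_subtractf sum_distrib_left)

text \<open>For orthonormal \<open>b\<close> this is the component of \<open>v\<close> orthogonal to
  the span of \<open>b\<close>.\<close>

definition resid :: "nat \<Rightarrow> (nat \<Rightarrow> nat \<Rightarrow> real) \<Rightarrow> nat \<Rightarrow> (nat \<Rightarrow> real) \<Rightarrow> nat \<Rightarrow> real" where
  "resid n b t v = (\<lambda>i. v i - embed n b t (\<lambda>j. inner_n n v (b j)) i)"

lemma sqnorm_resid:
  assumes "orthonormal n b t"
  shows "sqnorm n (resid n b t v) = sqnorm n v - (\<Sum>j<t. (inner_n n v (b j))\<^sup>2)"
  unfolding resid_def by (simp add: sqnorm_diff_embed[OF assms])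

lemma inner_n_resid:
  assumes "orthonormal n b t" "l < t"
  shows "inner_n n (resid n b t v) (b l) = 0"
proof -
  have "inner_n n (resid n b t v) (b l) =
      inner_n n v (b l) - (\<Sum>j<t. inner_n n v (b j) * inner_n n (b l) (b j))"
    unfolding resid_def inner_n_diff inner_n_commute[of n "embed n b t _"] inner_n_embed ..
  also have "(\<Sum>j<t. inner_n n v (b j) * inner_n n (b l) (b j)) =
      (\<Sum>j<t. if j = l then inner_n n v (b l) else 0)"
    using assms by (intro sum.cong) (auto simp: orthonormal_def)
  finally show ?thesis using assms by simp
qed

text \<open>If \<open>v\<close> lies in the span of \<open>b\<close>, the new vector is \<open>0\<close>, because \<open>x / 0 = 0\<close>.\<close>

definition extend :: "nat \<Rightarrow> (nat \<Rightarrow> nat \<Rightarrow> real) \<Rightarrow> nat \<Rightarrow> (nat \<Rightarrow> real) \<Rightarrow> nat \<Rightarrow> nat \<Rightarrow> real" where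
  "extend n b t v = b(t := (\<lambda>i. resid n b t v i / sqrt (sqnorm n (resid n b t v))))"

lemma extend_less: "j < t \<Longrightarrow> extend n b t v j = b j"
  by (simp add: extend_def)

lemma inner_n_extend_last:
  "inner_n n (extend n b t v t) w = inner_n n (resid n b t v) w / sqrt (sqnorm n (resid n b t v))"
proof -
  have "extend n b t v t = (\<lambda>i. inverse (sqrt (sqnorm n (resid n b t v))) * resid n b t v i)"
    by (simp add: extend_def field_simps fun_eq_iff)
  thus ?thesis by (simp only: inner_n_scale) (simp add: field_simps)
qed

lemma sqnorm_extend_last:
  "sqnorm n (extend n b t v t) = (if sqnorm n (resid n b t v) = 0 then 0 else 1)"
  using sqnorm_nonneg[of n "resid n b t v"]
  unfolding sqnorm_inner[of n "extend n b t v t"]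
  by (subst inner_n_extend_last, subst inner_n_commute, subst inner_n_extend_last)
     (auto simp: sqnorm_inner[symmetric] field_simps)

lemma inner_n_extend:
  assumes "orthonormal n b t" "l < t"
  shows "inner_n n (extend n b t v t) (b l) = 0"
  using assms by (simp add: inner_n_extend_last inner_n_resid)

lemma extend_orthogonal:
  assumes "orthonormal n b t" "j < Suc t" "l < Suc t" "j \<noteq> l"
  shows "inner_n n (extend n b t v j) (extend n b t v l) = 0"
proof -
  consider "j < t" "l < t" | "j = t" "l < t" | "j < t" "l = t"
    using assms by linarith
  thus ?thesis
  proof cases
    case 1 thus ?thesis using assms by (simp add: extend_less orthonormalD)
  next
    case 2 thus ?thesis using assms by (simp add: extend_less[of l] inner_n_extend)
  next
    case 3 thus ?thesis
      using assms by (subst inner_n_commute) (simp add: extend_less[of j] inner_n_extend)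
  qed
qed

text \<open>Only an inequality, because the last vector may be 0. This is the hypothesis of
  \<open>nn_integral_gauss_exp_quadratic\<close>, which thus applies without a case split on whether
  \<open>v\<close> lies in the span.\<close>

lemma sqnorm_embed_extend_le:
  assumes "orthonormal n b t"
  shows "sqnorm n (embed n (extend n b t v) (Suc t) c) \<le> (\<Sum>j<Suc t. (c j)\<^sup>2)"
proof -
  have "sqnorm n (extend n b t v j) \<le> 1" if "j < Suc t" for j
  proof (cases "j = t")
    case True thus ?thesis by (simp add: sqnorm_extend_last)
  next
    case False thus ?thesis
      using that assms by (simp add: extend_less sqnorm_inner orthonormalD)
  qed
  thus ?thesis
    by (subst sqnorm_embed_orthogonal) (auto simp: extend_orthogonal assms
        intro!: sum_mono mult_left_le simp del: sum.lessThan_Suc)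
qed

lemma orthonormal_extend:
  assumes "orthonormal n b t" "sqnorm n (resid n b t v) \<noteq> 0"
  shows "orthonormal n (extend n b t v) (Suc t)"
proof -
  have "inner_n n (extend n b t v j) (extend n b t v j) = 1" if "j < Suc t" for j
  proof (cases "j = t")
    case True thus ?thesis
      using assms by (simp add: sqnorm_inner[symmetric] sqnorm_extend_last)
  next
    case False thus ?thesis
      using that assms by (simp add: extend_less orthonormalD)
  qed
  thus ?thesis
    using extend_orthogonal[OF assms(1)] by (auto simp: orthonormal_def)
qed

lemma mult_le_square_plus_quarter: "x * y \<le> x\<^sup>2 + y\<^sup>2 / 4" for x y :: real
proof -
  have "0 \<le> (x - y / 2)\<^sup>2" by simp
  thus ?thesis by (simp add: power2_eq_square algebra_simps)
qed

text \<open>The difference lies in the span of the extended system, so the inner product splits into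
  coordinates, and \<open>x * y \<le> x^2 + y^2 / 4\<close> is applied to each. The weight 1/4
  leaves a quarter of the squared norm to spare against the half in the Gaussian exponent.\<close>

lemma inner_n_embed_minus_le:
  assumes b: "orthonormal n b t"
  shows "inner_n n e (\<lambda>i. embed n b t c i - v i) \<le>
    (\<Sum>j<Suc t. (inner_n n e (extend n b t v j))\<^sup>2) + sqnorm n (\<lambda>i. embed n b t c i - v i) / 4"
proof -
  let ?r = "resid n b t v" and ?m = "\<lambda>j. inner_n n v (b j)"
  \<comment> \<open>The coordinates of the difference are \<open>c j - ?m j\<close> for
    \<open>j < t\<close>, and minus the length of the residual of \<open>v\<close> in the new
    direction. If the residual vanishes, both sides of the auxiliary identity are 0.\<close>
  have dec: "inner_n n e (\<lambda>i. embed n b t c i - v i) =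
      (\<Sum>j<t. inner_n n e (b j) * (c j - ?m j)) + inner_n n e (extend n b t v t) * (- sqrt (sqnorm n ?r))"
  proof -
    have "inner_n n e (extend n b t v t) * sqrt (sqnorm n ?r) = inner_n n ?r e"
    proof (cases "sqnorm n ?r = 0")
      case True
      hence "\<forall>i<n. ?r i = 0" by (simp only: sqnorm_eq_0)
      hence "inner_n n ?r e = 0" by (simp add: inner_n_def)
      thus ?thesis using True by simp
    next
      case False
      thus ?thesis by (subst inner_n_commute) (simp add: inner_n_extend_last)
    qed
    moreover have "inner_n n ?r e = inner_n n v e - (\<Sum>j<t. ?m j * inner_n n e (b j))"
      unfolding resid_def inner_n_diff inner_n_commute[of n "embed n b t _"] inner_n_embed ..
    moreover have "inner_n n e (\<lambda>i. embed n b t c i - v i) = (\<Sum>j<t. c j * inner_n n e (b j)) - inner_n n v e"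
      using inner_n_diff[of n "embed n b t c" v e] inner_n_embed[of n e b t c]
      by (simp add: inner_n_commute[of n _ e])
    ultimately show ?thesis by (simp add: algebra_simps sum_subtractf)
  qed
  have nrm: "sqnorm n (\<lambda>i. embed n b t c i - v i) = (\<Sum>j<t. (c j - ?m j)\<^sup>2) + (- sqrt (sqnorm n ?r))\<^sup>2"
  proof -
    have "sqnorm n (\<lambda>i. embed n b t c i - v i) = sqnorm n (\<lambda>i. v i - embed n b t c i)"
      by (simp add: sqnorm_def power2_commute)
    thus ?thesis
      by (simp add: sqnorm_diff_embed[OF b] sqnorm_nonneg sqnorm_resid[OF b, symmetric])
  qed
  have "(\<Sum>j<t. inner_n n e (b j) * (c j - ?m j)) \<le> (\<Sum>j<t. (inner_n n e (b j))\<^sup>2 + (c j - ?m j)\<^sup>2 / 4)"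
    by (intro sum_mono mult_le_square_plus_quarter)
  moreover have "inner_n n e (extend n b t v t) * (- sqrt (sqnorm n ?r)) \<le>
      (inner_n n e (extend n b t v t))\<^sup>2 + (- sqrt (sqnorm n ?r))\<^sup>2 / 4"
    by (rule mult_le_square_plus_quarter)
  ultimately show ?thesis
    unfolding dec nrm by (simp add: sum.distrib sum_divide_distrib extend_less add_divide_distrib)
qed

section \<open>Orthonormal bases of subspaces\<close>

lemma orthonormal_inj: "orthonormal n b t \<Longrightarrow> inj_on b {..<t}"
  by (intro inj_onI) (metis lessThan_iff orthonormal_def zero_neq_one)

lemma orthonormal_independent:
  assumes "orthonormal n b t"
  shows "fv.independent (b ` {..<t})"
proof (rule fv.independent_if_scalars_zero)
  fix f x assume s: "(\<Sum>x\<in>b ` {..<t}. (\<lambda>i. f x * x i)) = 0" and "x \<in> b ` {..<t}"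
  then obtain l where l: "l < t" "x = b l" by auto
  have "(\<Sum>j<t. (\<lambda>i. f (b j) * b j i)) = 0"
    using s by (simp add: sum.reindex orthonormal_inj[OF assms])
  hence "\<And>i. (\<Sum>j<t. f (b j) * b j i) = 0"
    by (metis (no_types, lifting) sum_fun_apply zero_fun_apply sum.cong)
  hence "inner_n n (b l) (embed n b t (\<lambda>j. f (b j))) = 0"
    by (simp add: embed_def inner_n_def)
  hence "(\<Sum>j<t. f (b j) * inner_n n (b l) (b j)) = 0"
    by (simp add: inner_n_embed)
  moreover have "(\<Sum>j<t. f (b j) * inner_n n (b l) (b j)) = (\<Sum>j<t. if j = l then f x else 0)"
    using assms l by (intro sum.cong) (auto simp: orthonormal_def)
  ultimately show "f x = 0" using l by simp
qed simp

text \<open>The ambient space of all functions \<open>nat => real\<close> is infinite-dimensional;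
  this predicate places \<open>V\<close> in its copy of R^n, which gives finite spanning sets and
  makes \<open>inner_n n\<close> definite on \<open>V\<close>.\<close>

definition supported :: "nat \<Rightarrow> (nat \<Rightarrow> real) set \<Rightarrow> bool" where
  "supported n V \<longleftrightarrow> (\<forall>v\<in>V. \<forall>i\<ge>n. v i = 0)"

lemma embed_sum:
  assumes "\<And>j. j < t \<Longrightarrow> \<forall>i\<ge>n. b j i = 0"
  shows "embed n b t c = (\<Sum>j<t. (\<lambda>i. c j * b j i))"
  using assms by (auto simp: fun_eq_iff embed_def sum_fun_apply)

lemma extend_mem:
  assumes V: "fv.subspace V" "supported n V" and b: "\<And>j. j < t \<Longrightarrow> b j \<in> V" and v: "v \<in> V"
    and j: "j < Suc t"
  shows "extend n b t v j \<in> V"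
proof (cases "j = t")
  case True
  have "embed n b t (\<lambda>j. inner_n n v (b j)) \<in> V"
    using b V by (subst embed_sum) (auto simp: supported_def intro!: fv.subspace_sum fv.subspace_scale)
  hence "resid n b t v \<in> V"
    using fv.subspace_diff[OF V(1) v] by (simp add: resid_def fun_diff_def)
  from fv.subspace_scale[OF V(1) this, of "inverse (sqrt (sqnorm n (resid n b t v)))"]
  show ?thesis using True by (simp add: extend_def field_simps)
next
  case False
  thus ?thesis using j b by (simp add: extend_less)
qed

lemma supported_finite_span:
  assumes "supported n V"
  obtains B where "finite B" "card B \<le> n" "V \<subseteq> fv.span B"
proof
  let ?B = "(\<lambda>k i. if i = k then 1 else 0 :: real) ` {..<n}"
  show "finite ?B" "card ?B \<le> n" by (auto intro: card_image_le[THEN order_trans])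
  show "V \<subseteq> fv.span ?B"
  proof
    fix v assume v: "v \<in> V"
    have eq: "v = (\<Sum>k<n. (\<lambda>i. v k * (if i = k then 1 else 0)))"
    proof
      fix i
      have "(\<Sum>k<n. v k * (if i = k then 1 else 0)) = (\<Sum>k<n. if k = i then v i else 0)"
        by (intro sum.cong) auto
      thus "v i = (\<Sum>k<n. (\<lambda>i. v k * (if i = k then 1 else 0))) i"
        using v assms by (auto simp: supported_def sum_fun_apply)
    qed
    thus "v \<in> fv.span ?B"
      by (subst eq, intro fv.span_sum fv.span_scale fv.span_base) auto
  qed
qed

lemma vdim_le:
  assumes "supported n V"
  shows "vdim V \<le> n"
  using supported_finite_span[OF assms] fv.dim_le_card by (metis order_trans)

text \<open>Gram-Schmidt: as long as \<open>k < vdim V\<close>, the \<open>k\<close> vectors found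
  so far cannot span \<open>V\<close>, and a vector of \<open>V\<close> outside their span has a
  nonzero residual to normalise.\<close>

lemma ex_orthonormal:
  assumes V: "fv.subspace V" "supported n V" and "k \<le> vdim V"
  shows "\<exists>b. (\<forall>j<k. b j \<in> V) \<and> orthonormal n b k"
  using assms(3)
proof (induction k)
  case 0
  show ?case by (auto simp: orthonormal_def)
next
  case (Suc k)
  then obtain b where b: "\<And>j. j < k \<Longrightarrow> b j \<in> V" "orthonormal n b k" by auto
  have "\<not> V \<subseteq> fv.span (b ` {..<k})"
    using Suc.prems fv.dim_le_card[of V "b ` {..<k}"] card_image_le[of "{..<k}" b] by auto
  then obtain v where v: "v \<in> V" "v \<notin> fv.span (b ` {..<k})" by auto
  have "sqnorm n (resid n b k v) \<noteq> 0"
  proof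
    assume "sqnorm n (resid n b k v) = 0"
    hence "v i = embed n b k (\<lambda>j. inner_n n v (b j)) i" for i
      using v V(2) by (cases "i < n") (auto simp: sqnorm_eq_0 resid_def embed_def supported_def)
    hence "v = embed n b k (\<lambda>j. inner_n n v (b j))" by blast
    also have "\<dots> = (\<Sum>j<k. (\<lambda>i. inner_n n v (b j) * b j i))"
      using b(1) V(2) by (intro embed_sum) (auto simp: supported_def)
    also have "\<dots> \<in> fv.span (b ` {..<k})"
      by (intro fv.span_sum fv.span_scale fv.span_base) auto
    finally show False using v by simp
  qed
  hence "orthonormal n (extend n b k v) (Suc k)" by (rule orthonormal_extend[OF b(2)])
  moreover have "\<forall>j<Suc k. extend n b k v j \<in> V"
    using extend_mem[OF V b(1) v(1)] by simp
  ultimately show ?case by (intro exI conjI)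
qed

text \<open>The choice in \<open>onb\<close> is legitimate: the case \<open>k = vdim V\<close> of
  the existence lemma supplies a witness.\<close>

lemma
  assumes "fv.subspace V" "supported n V"
  shows onb_mem: "j < vdim V \<Longrightarrow> onb n V j \<in> V"
    and onb_orthonormal: "orthonormal n (onb n V) (vdim V)"
  using someI_ex[OF ex_orthonormal[OF assms order_refl]]
  unfolding onb_def orthonormal_def by blast+

text \<open>A nonzero residual would extend the system to \<open>vdim V + 1\<close> independent
  vectors in \<open>V\<close>. Hence the parametrisation used in \<open>lebV_int\<close> reaches
  every point of \<open>V\<close>.\<close>

lemma onb_embed:
  assumes V: "fv.subspace V" "supported n V" and v: "v \<in> V"
  shows "embed n (onb n V) (vdim V) (\<lambda>j. inner_n n v (onb n V j)) = v"
proof -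
  let ?b = "onb n V" and ?t = "vdim V"
  have "sqnorm n (resid n ?b ?t v) = 0"
  proof (rule ccontr)
    assume "sqnorm n (resid n ?b ?t v) \<noteq> 0"
    hence o: "orthonormal n (extend n ?b ?t v) (Suc ?t)"
      by (rule orthonormal_extend[OF onb_orthonormal[OF V]])
    let ?E = "extend n ?b ?t v ` {..<Suc ?t}"
    obtain W where W: "finite W" "V \<subseteq> fv.span W" using supported_finite_span[OF V(2)] by metis
    obtain B where B: "B \<subseteq> V" "fv.independent B" "V \<subseteq> fv.span B" "card B = vdim V"
      using fv.basis_exists by blast
    have "finite B" using fv.independent_span_bound[OF W(1) B(2)] B(1) W(2) by blast
    moreover have "?E \<subseteq> fv.span B"
    proof
      fix x assume "x \<in> ?E"
      then obtain j where "j < Suc ?t" "x = extend n ?b ?t v j" by auto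
      hence "x \<in> V" using extend_mem[OF V _ v, of ?t ?b j] onb_mem[OF V] by simp
      thus "x \<in> fv.span B" using B(3) by auto
    qed
    ultimately have "card ?E \<le> card B"
      using fv.independent_span_bound[OF _ orthonormal_independent[OF o]] by blast
    thus False using B(4) by (simp add: card_image[OF orthonormal_inj[OF o]])
  qed
  thus ?thesis
    using v V(2) by (auto simp: sqnorm_eq_0 resid_def embed_def supported_def fun_eq_iff)
qed

section \<open>Column spaces and their number in each dimension\<close>

lemma supported_colspace: "supported n (colspace X n p S)"
  by (auto simp: supported_def colspace_def Xmul_def)

lemma colspace_span:
  assumes "S \<subseteq> {..<p}"
  shows "colspace X n p S = fv.span ((\<lambda>j i. if i < n then X n p i j else 0) ` S)" (is "_ = fv.span (?c ` S)")
proof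
  have fin: "finite S" using assms finite_subset by blast
  show "colspace X n p S \<subseteq> fv.span (?c ` S)"
  proof
    fix v assume "v \<in> colspace X n p S"
    then obtain \<beta> where v: "v = Xmul X n p \<beta>" and z: "\<forall>j<p. \<beta> j = 0 \<or> j \<in> S"
      by (auto simp: colspace_def)
    have "v = (\<Sum>j\<in>S. (\<lambda>i. \<beta> j * ?c j i))"
    proof
      fix i
      have "(\<Sum>j<p. X n p i j * \<beta> j) = (\<Sum>j\<in>S. X n p i j * \<beta> j)"
        using assms z by (intro sum.mono_neutral_right) auto
      thus "v i = (\<Sum>j\<in>S. (\<lambda>i. \<beta> j * ?c j i)) i"
        by (simp add: v Xmul_def sum_fun_apply mult.commute)
    qed
    also have "\<dots> \<in> fv.span (?c ` S)"
      by (intro fv.span_sum fv.span_scale fv.span_base) auto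
    finally show "v \<in> fv.span (?c ` S)" .
  qed
  have "fv.subspace (colspace X n p S)"
    unfolding fv.subspace_def
  proof (intro conjI ballI allI)
    show "0 \<in> colspace X n p S"
      by (auto simp: colspace_def Xmul_def fun_eq_iff intro!: exI[of _ "\<lambda>_. 0"])
  next
    fix x y assume "x \<in> colspace X n p S" "y \<in> colspace X n p S"
    then obtain \<beta> \<gamma> where "x = Xmul X n p \<beta>" "\<forall>j<p. \<beta> j = 0 \<or> j \<in> S" "\<forall>j\<ge>p. \<beta> j = 0"
      "y = Xmul X n p \<gamma>" "\<forall>j<p. \<gamma> j = 0 \<or> j \<in> S" "\<forall>j\<ge>p. \<gamma> j = 0"
      by (auto simp: colspace_def)
    hence "x + y = Xmul X n p (\<lambda>j. \<beta> j + \<gamma> j)" "\<forall>j<p. \<beta> j + \<gamma> j = 0 \<or> j \<in> S" "\<forall>j\<ge>p. \<beta> j + \<gamma> j = 0"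
      by (force simp: Xmul_def fun_eq_iff sum.distrib distrib_left)+
    thus "x + y \<in> colspace X n p S"
      unfolding colspace_def by blast
  next
    fix c x assume "x \<in> colspace X n p S"
    then obtain \<beta> where "x = Xmul X n p \<beta>" "\<forall>j<p. \<beta> j = 0 \<or> j \<in> S" "\<forall>j\<ge>p. \<beta> j = 0"
      by (auto simp: colspace_def)
    hence "(\<lambda>i. c * x i) = Xmul X n p (\<lambda>j. c * \<beta> j)" "\<forall>j<p. c * \<beta> j = 0 \<or> j \<in> S" "\<forall>j\<ge>p. c * \<beta> j = 0"
      by (auto simp: Xmul_def fun_eq_iff sum_distrib_left mult.left_commute)
    thus "(\<lambda>i. c * x i) \<in> colspace X n p S"
      unfolding colspace_def by blast
  qed
  moreover have "?c ` S \<subseteq> colspace X n p S"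
  proof
    fix v assume "v \<in> ?c ` S"
    then obtain l where l: "l \<in> S" "v = ?c l" by auto
    have "(\<Sum>j<p. X n p i j * (if j = l then 1 else 0)) = (\<Sum>j<p. if j = l then X n p i l else 0)" for i
      by (intro sum.cong) auto
    hence "v = Xmul X n p (\<lambda>j. if j = l then 1 else 0)"
      using l assms by (auto simp: Xmul_def fun_eq_iff)
    thus "v \<in> colspace X n p S"
      using l assms by (auto simp: colspace_def intro!: exI[of _ "\<lambda>j. if j = l then 1 else 0"])
  qed
  ultimately show "fv.span (?c ` S) \<subseteq> colspace X n p S"
    by (intro fv.span_minimal)
qed

lemma Vcoll_subspace: "V \<in> Vcoll X n p \<Longrightarrow> fv.subspace V"
  unfolding Vcoll_def using colspace_span fv.subspace_span by fastforce

lemma Vcoll_supported: "V \<in> Vcoll X n p \<Longrightarrow> supported n V"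
  unfolding Vcoll_def using supported_colspace by blast

lemma finite_Vcoll: "finite (Vcoll X n p)"
proof -
  have "Vcoll X n p = colspace X n p ` Pow {..<p}" by (auto simp: Vcoll_def)
  thus ?thesis by simp
qed

text \<open>A column space of dimension \<open>t\<close> is spanned by \<open>t\<close> independent
  columns, so it is determined by a set of \<open>t\<close> indices, and there are
  \<open>p choose t\<close> of those.\<close>

lemma card_Vcoll_vdim_le: "card {V \<in> Vcoll X n p. vdim V = t} \<le> p ^ t"
proof -
  have "{V \<in> Vcoll X n p. vdim V = t} \<subseteq> colspace X n p ` {S. S \<subseteq> {..<p} \<and> card S = t}"
  proof
    fix V assume "V \<in> {V \<in> Vcoll X n p. vdim V = t}"
    then obtain S where S: "S \<subseteq> {..<p}" "V = colspace X n p S" "vdim V = t"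
      by (auto simp: Vcoll_def)
    let ?c = "\<lambda>j i. if i < n then X n p i j else 0"
    obtain B where B: "B \<subseteq> ?c ` S" "fv.independent B" "?c ` S \<subseteq> fv.span B"
      using fv.maximal_independent_subset by blast
    have sp: "fv.span B = fv.span (?c ` S)"
      using B by (intro fv.span_subspace[symmetric] fv.span_minimal subset_antisym fv.span_mono)
         (auto simp: fv.subspace_span)
    \<comment> \<open>Different indices may carry the same column, so an index set on which the
      column map is injective is selected; only then do \<open>U\<close> and \<open>B\<close> have
      equal size.\<close>
    obtain U where U: "U \<subseteq> S" "inj_on ?c U" "B = ?c ` U"
      using B(1) by (auto simp: subset_image_inj)
    have "card U = t"
      using S sp U B(2) by (simp add: colspace_span fv.dim_eq_card card_image[symmetric])
    moreover have "V = colspace X n p U"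
      using S U sp by (simp add: colspace_span)
    ultimately show "V \<in> colspace X n p ` {S. S \<subseteq> {..<p} \<and> card S = t}"
      using S U by auto
  qed
  hence "card {V \<in> Vcoll X n p. vdim V = t} \<le> card {S. S \<subseteq> {..<p} \<and> card S = t}"
    by (intro surj_card_le) auto
  also have "\<dots> = p choose t" by (simp add: n_subsets)
  also have "\<dots> \<le> p ^ t"
    by (cases "t \<le> p") (auto intro: binomial_le_pow simp: binomial_eq_0)
  finally show ?thesis .
qed

subsection \<open>Gaussian integrals\<close>

lemma nn_integral_normal_density:
  assumes "\<sigma> > 0"
  shows "(\<integral>\<^sup>+x. ennreal (normal_density m \<sigma> x) \<partial>lborel) = 1"
  using assms by (subst nn_integral_eq_integral) auto

text \<open>Completing the square turns the integrand into a constant times the normal density with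
  mean \<open>m + a\<close>.\<close>

lemma nn_integral_normal_exp_linear:
  "(\<integral>\<^sup>+y. ennreal (exp (a * (y - m))) \<partial>density lborel (normal_density m 1)) = ennreal (exp (a\<^sup>2 / 2))"
proof -
  have eq: "normal_density m 1 y * exp (a * (y - m)) = exp (a\<^sup>2 / 2) * normal_density (m + a) 1 y" for y
  proof -
    have "- (y - m)\<^sup>2 / 2 + a * (y - m) = a\<^sup>2 / 2 + - (y - (m + a))\<^sup>2 / 2"
      by (simp add: power2_eq_square field_simps)
    hence "exp (- (y - m)\<^sup>2 / 2) * exp (a * (y - m)) = exp (a\<^sup>2 / 2) * exp (- (y - (m + a))\<^sup>2 / 2)"
      by (simp only: exp_add[symmetric])
    thus ?thesis by (simp add: normal_density_def)
  qed
  have "(\<integral>\<^sup>+y. ennreal (exp (a * (y - m))) \<partial>density lborel (normal_density m 1)) =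
      (\<integral>\<^sup>+y. ennreal (exp (a\<^sup>2 / 2)) * ennreal (normal_density (m + a) 1 y) \<partial>lborel)"
    by (subst nn_integral_density) (auto simp: ennreal_mult'[symmetric] eq)
  also have "\<dots> = ennreal (exp (a\<^sup>2 / 2))"
    by (subst nn_integral_cmult) (auto simp: nn_integral_normal_density)
  finally show ?thesis .
qed

text \<open>The factor changes the exponent from \<open>- y^2 / 2\<close> to
  \<open>- y^2 / 4\<close>, that is, variance 1 into variance 2; \<open>sqrt 2\<close> is the
  quotient of the normalising constants.\<close>

lemma nn_integral_normal_exp_square:
  "(\<integral>\<^sup>+y. ennreal (exp (y\<^sup>2 / 4)) \<partial>density lborel (normal_density 0 1)) = ennreal (sqrt 2)"
proof -
  have eq: "normal_density 0 1 y * exp (y\<^sup>2 / 4) = sqrt 2 * normal_density 0 (sqrt 2) y" for y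
  proof -
    have "exp (- y\<^sup>2 / 2) * exp (y\<^sup>2 / 4) = exp (- y\<^sup>2 / 4)"
      by (simp add: exp_add[symmetric])
    thus ?thesis by (simp add: normal_density_def real_sqrt_mult field_simps)
  qed
  have "(\<integral>\<^sup>+y. ennreal (exp (y\<^sup>2 / 4)) \<partial>density lborel (normal_density 0 1)) =
      (\<integral>\<^sup>+y. ennreal (sqrt 2) * ennreal (normal_density 0 (sqrt 2) y) \<partial>lborel)"
    by (subst nn_integral_density) (auto simp: ennreal_mult'[symmetric] eq)
  also have "\<dots> = ennreal (sqrt 2)"
    by (subst nn_integral_cmult) (auto simp: nn_integral_normal_density)
  finally show ?thesis .
qed

lemma product_prob_space_gauss:
  "product_prob_space (\<lambda>i. density lborel (\<lambda>x. ennreal (normal_density (\<mu> i) 1 x)))"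
  by (intro product_prob_spaceI prob_space_normal_density) simp

lemma prob_space_gauss_n: "prob_space (gauss_n n \<mu>)"
  unfolding gauss_n_def by (intro prob_space_PiM prob_space_normal_density) simp

lemma nn_integral_gauss_prod:
  assumes "\<And>i. i < n \<Longrightarrow> f i \<in> borel_measurable borel"
  shows "(\<integral>\<^sup>+Y. (\<Prod>i<n. f i (Y i)) \<partial>gauss_n n \<mu>) =
    (\<Prod>i<n. \<integral>\<^sup>+y. f i y \<partial>density lborel (normal_density (\<mu> i) 1))"
proof -
  interpret product_prob_space "\<lambda>i. density lborel (\<lambda>x. ennreal (normal_density (\<mu> i) 1 x))" UNIV
    by (rule product_prob_space_gauss)
  show ?thesis
    unfolding gauss_n_def using assms by (subst product_nn_integral_prod) auto
qed

lemma nn_integral_gauss_exp_linear: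
  "(\<integral>\<^sup>+Y. ennreal (exp (\<Sum>i<n. a i * (Y i - \<mu> i))) \<partial>gauss_n n \<mu>) = ennreal (exp ((\<Sum>i<n. (a i)\<^sup>2) / 2))"
proof -
  have "(\<integral>\<^sup>+Y. ennreal (exp (\<Sum>i<n. a i * (Y i - \<mu> i))) \<partial>gauss_n n \<mu>) =
      (\<integral>\<^sup>+Y. (\<Prod>i<n. ennreal (exp (a i * (Y i - \<mu> i)))) \<partial>gauss_n n \<mu>)"
    by (simp add: exp_sum prod_ennreal)
  also have "\<dots> = (\<Prod>i<n. ennreal (exp ((a i)\<^sup>2 / 2)))"
    by (subst nn_integral_gauss_prod) (auto simp: nn_integral_normal_exp_linear)
  also have "\<dots> = ennreal (exp ((\<Sum>i<n. (a i)\<^sup>2) / 2))"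
    by (simp add: exp_sum prod_ennreal sum_divide_distrib)
  finally show ?thesis .
qed

lemma sets_gauss_n: "sets (gauss_n n \<mu>) = sets (Pi\<^sub>M {..<n} (\<lambda>_. borel))"
  unfolding gauss_n_def by (intro sets_PiM_cong) auto

text \<open>The Gaussian integral \<open>exp (x\<^sup>2 / 4) = E exp (x * g / sqrt 2)\<close> linearises the quadratic form;
  after exchanging the integrals only moment generating functions of product measures occur, so no
  rotation invariance is needed.\<close>

lemma nn_integral_gauss_exp_quadratic:
  assumes "\<And>c. sqnorm n (embed n b t c) \<le> (\<Sum>j<t. (c j)\<^sup>2)"
  shows "(\<integral>\<^sup>+Y. ennreal (exp ((\<Sum>j<t. (inner_n n (\<lambda>i. Y i - \<mu> i) (b j))\<^sup>2) / 4)) \<partial>gauss_n n \<mu>)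
    \<le> ennreal (sqrt 2 ^ t)"
proof -
  let ?G = "gauss_n t (\<lambda>_. 0)" and ?N = "gauss_n n \<mu>"
  let ?x = "\<lambda>Y j. inner_n n (\<lambda>i. Y i - \<mu> i) (b j)"
  interpret G: prob_space ?G by (rule prob_space_gauss_n)
  interpret N: prob_space ?N by (rule prob_space_gauss_n)
  interpret P: pair_sigma_finite ?N ?G ..
  have "(\<integral>\<^sup>+Y. ennreal (exp ((\<Sum>j<t. (?x Y j)\<^sup>2) / 4)) \<partial>?N) =
      (\<integral>\<^sup>+Y. \<integral>\<^sup>+g. ennreal (exp (\<Sum>j<t. ?x Y j / sqrt 2 * (g j - 0))) \<partial>?G \<partial>?N)"
    by (subst nn_integral_gauss_exp_linear) (simp add: power_divide sum_divide_distrib)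
  also have "\<dots> = (\<integral>\<^sup>+g. \<integral>\<^sup>+Y. ennreal (exp (\<Sum>j<t. ?x Y j / sqrt 2 * (g j - 0))) \<partial>?N \<partial>?G)"
  proof (rule P.Fubini'[symmetric])
    have "sets (?N \<Otimes>\<^sub>M ?G) = sets (Pi\<^sub>M {..<n} (\<lambda>_. borel :: real measure) \<Otimes>\<^sub>M Pi\<^sub>M {..<t} (\<lambda>_. borel :: real measure))"
      by (intro sets_pair_measure_cong sets_gauss_n)
    moreover have "(\<lambda>(Y, g). ennreal (exp (\<Sum>j<t. ?x Y j / sqrt 2 * (g j - 0))))
        \<in> borel_measurable (Pi\<^sub>M {..<n} (\<lambda>_. borel :: real measure) \<Otimes>\<^sub>M Pi\<^sub>M {..<t} (\<lambda>_. borel :: real measure))"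
      unfolding inner_n_def by measurable
    ultimately show "(\<lambda>(Y, g). ennreal (exp (\<Sum>j<t. ?x Y j / sqrt 2 * (g j - 0))))
        \<in> borel_measurable (?N \<Otimes>\<^sub>M ?G)"
      by (simp cong: measurable_cong_sets)
  qed
  also have "\<dots> = (\<integral>\<^sup>+g. ennreal (exp (sqnorm n (embed n b t g) / 4)) \<partial>?G)"
  proof (rule nn_integral_cong)
    fix g
    \<comment> \<open>The exponent is bilinear in \<open>g\<close> and \<open>Y - \<mu>\<close>, so
      for fixed \<open>g\<close> it is a linear form in \<open>Y\<close> and the moment generating
      function applies a second time.\<close>
    have eq: "(\<Sum>j<t. ?x Y j / sqrt 2 * (g j - 0)) = (\<Sum>i<n. embed n b t g i / sqrt 2 * (Y i - \<mu> i))" for Y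
    proof -
      have "(\<Sum>j<t. ?x Y j / sqrt 2 * (g j - 0)) = inner_n n (\<lambda>i. Y i - \<mu> i) (embed n b t g) / sqrt 2"
        by (simp add: inner_n_embed sum_divide_distrib mult.commute)
      thus ?thesis by (simp add: inner_n_def sum_divide_distrib mult.commute)
    qed
    show "(\<integral>\<^sup>+Y. ennreal (exp (\<Sum>j<t. ?x Y j / sqrt 2 * (g j - 0))) \<partial>?N) =
        ennreal (exp (sqnorm n (embed n b t g) / 4))"
      unfolding eq by (subst nn_integral_gauss_exp_linear) (simp add: power_divide sum_divide_distrib sqnorm_def)
  qed
  \<comment> \<open>The hypothesis on \<open>b\<close> replaces the coupled quadratic form in
    \<open>g\<close> by a sum of squares, so that the integral splits into one-dimensional
    ones.\<close>
  also have "\<dots> \<le> (\<integral>\<^sup>+g. (\<Prod>j<t. ennreal (exp ((g j)\<^sup>2 / 4))) \<partial>?G)"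
  proof (rule nn_integral_mono)
    fix g
    have "exp (sqnorm n (embed n b t g) / 4) \<le> exp (\<Sum>j<t. (g j)\<^sup>2 / 4)"
      using assms[of g] by (simp add: sum_divide_distrib[symmetric])
    also have "\<dots> = (\<Prod>j<t. exp ((g j)\<^sup>2 / 4))" by (simp add: exp_sum)
    finally show "ennreal (exp (sqnorm n (embed n b t g) / 4)) \<le> (\<Prod>j<t. ennreal (exp ((g j)\<^sup>2 / 4)))"
      by (simp add: prod_ennreal ennreal_leI)
  qed
  also have "\<dots> = ennreal (sqrt 2 ^ t)"
    by (subst nn_integral_gauss_prod) (auto simp: nn_integral_normal_exp_square ennreal_power)
  finally show ?thesis .
qed

lemma
  assumes "\<And>c. sqnorm n (embed n b t c) \<le> (\<Sum>j<t. (c j)\<^sup>2)"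
  shows integrable_gauss_exp_quadratic:
      "integrable (gauss_n n \<mu>) (\<lambda>Y. exp ((\<Sum>j<t. (inner_n n (\<lambda>i. Y i - \<mu> i) (b j))\<^sup>2) / 4))" (is "integrable _ ?f")
    and integral_gauss_exp_quadratic_le:
      "(\<integral>Y. exp ((\<Sum>j<t. (inner_n n (\<lambda>i. Y i - \<mu> i) (b j))\<^sup>2) / 4) \<partial>gauss_n n \<mu>) \<le> sqrt 2 ^ t"
proof -
  note le = nn_integral_gauss_exp_quadratic[OF assms, of \<mu>]
  have "?f \<in> borel_measurable (Pi\<^sub>M {..<n} (\<lambda>_. borel))"
    unfolding inner_n_def by measurable
  hence m: "?f \<in> borel_measurable (gauss_n n \<mu>)"
    using sets_gauss_n by (simp cong: measurable_cong_sets)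
  show "integrable (gauss_n n \<mu>) ?f"
    using le m by (auto simp: integrable_iff_bounded intro: le_less_trans)
  show "integral\<^sup>L (gauss_n n \<mu>) ?f \<le> sqrt 2 ^ t"
    using le m by (subst integral_eq_nn_integral) (auto intro!: enn2real_leI)
qed

section \<open>Gaussian integrals against Lebesgue measure on R^t\<close>

interpretation lborels: product_sigma_finite "\<lambda>_::nat. lborel :: real measure"
  by (simp add: product_sigma_finite_def lborel.sigma_finite_measure_axioms)

lemma
  assumes "\<sigma> > 0"
  shows integrable_exp_square: "integrable lborel (\<lambda>x. exp (- (x - m)\<^sup>2 / (2 * \<sigma>\<^sup>2)))"
    and integral_exp_square: "(\<integral>x. exp (- (x - m)\<^sup>2 / (2 * \<sigma>\<^sup>2)) \<partial>lborel) = sqrt (2 * pi * \<sigma>\<^sup>2)"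
proof -
  have eq: "(\<lambda>x. exp (- (x - m)\<^sup>2 / (2 * \<sigma>\<^sup>2))) = (\<lambda>x. sqrt (2 * pi * \<sigma>\<^sup>2) * normal_density m \<sigma> x)"
    using assms by (simp add: normal_density_def fun_eq_iff)
  show "integrable lborel (\<lambda>x. exp (- (x - m)\<^sup>2 / (2 * \<sigma>\<^sup>2)))"
    unfolding eq using assms by (intro integrable_mult_right) auto
  show "(\<integral>x. exp (- (x - m)\<^sup>2 / (2 * \<sigma>\<^sup>2)) \<partial>lborel) = sqrt (2 * pi * \<sigma>\<^sup>2)"
    unfolding eq using assms by simp
qed

lemma
  assumes "\<sigma> > 0"
  shows integrable_exp_square_PiM:
      "integrable (Pi\<^sub>M {..<t::nat} (\<lambda>_. lborel)) (\<lambda>c. exp (- (\<Sum>j<t. (c j - m j)\<^sup>2) / (2 * \<sigma>\<^sup>2)))"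
    and integral_exp_square_PiM:
      "(\<integral>c. exp (- (\<Sum>j<t. (c j - m j)\<^sup>2) / (2 * \<sigma>\<^sup>2)) \<partial>Pi\<^sub>M {..<t::nat} (\<lambda>_. lborel)) = sqrt (2 * pi * \<sigma>\<^sup>2) ^ t"
proof -
  have eq: "(\<lambda>c. exp (- (\<Sum>j<t. (c j - m j)\<^sup>2) / (2 * \<sigma>\<^sup>2))) = (\<lambda>c. \<Prod>j<t. exp (- (c j - m j)\<^sup>2 / (2 * \<sigma>\<^sup>2)))"
    by (simp only: exp_sum[symmetric] finite_lessThan sum_negf[symmetric] sum_divide_distrib)
  show "integrable (Pi\<^sub>M {..<t::nat} (\<lambda>_. lborel)) (\<lambda>c. exp (- (\<Sum>j<t. (c j - m j)\<^sup>2) / (2 * \<sigma>\<^sup>2)))"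
    unfolding eq using assms by (intro lborels.product_integrable_prod integrable_exp_square) auto
  show "(\<integral>c. exp (- (\<Sum>j<t. (c j - m j)\<^sup>2) / (2 * \<sigma>\<^sup>2)) \<partial>Pi\<^sub>M {..<t::nat} (\<lambda>_. lborel)) = sqrt (2 * pi * \<sigma>\<^sup>2) ^ t"
    unfolding eq using assms
    by (subst lborels.product_integral_prod) (simp_all only: integral_exp_square integrable_exp_square
        prod_constant card_lessThan finite_lessThan)
qed

subsection \<open>Integrals over a subspace\<close>

text \<open>The product measure over an empty index set is a unit point mass, so the Dirac case of
  the definition needs no separate treatment below.\<close>

lemma lebV_int_eq:
  "lebV_int n V f = (\<integral>c. f (embed n (onb n V) (vdim V) c) \<partial>Pi\<^sub>M {..<vdim V} (\<lambda>_. lborel))"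
proof (cases "vdim V = 0")
  case True
  have "embed n (onb n V) 0 c = (\<lambda>_. 0)" for c by (simp add: embed_def fun_eq_iff)
  thus ?thesis
    using True by (simp add: lebV_int_def PiM_empty lebesgue_integral_count_space_finite)
qed (simp add: lebV_int_def)

lemma
  assumes V: "fv.subspace V" "supported n V"
  shows integrable_lebV_exp:
      "integrable (Pi\<^sub>M {..<vdim V} (\<lambda>_. lborel))
         (\<lambda>c. exp (- sqnorm n (\<lambda>i. Y i - embed n (onb n V) (vdim V) c i) / 2))" (is ?i)
    and lebV_int_exp:
      "lebV_int n V (\<lambda>\<gamma>. exp (- sqnorm n (\<lambda>i. Y i - \<gamma> i) / 2)) =
         sqrt (2 * pi) ^ vdim V *
         exp (- (sqnorm n Y - (\<Sum>j<vdim V. (inner_n n Y (onb n V j))\<^sup>2)) / 2)" (is ?e)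
proof -
  let ?K = "exp (- (sqnorm n Y - (\<Sum>j<vdim V. (inner_n n Y (onb n V j))\<^sup>2)) / 2)"
  have eq: "exp (- sqnorm n (\<lambda>i. Y i - embed n (onb n V) (vdim V) c i) / 2) =
      ?K * exp (- (\<Sum>j<vdim V. (c j - inner_n n Y (onb n V j))\<^sup>2) / (2 * 1\<^sup>2))" for c
    unfolding sqnorm_diff_embed[OF onb_orthonormal[OF V]] exp_add[symmetric]
    by (simp add: field_simps)
  show ?i
    unfolding eq by (intro integrable_mult_right integrable_exp_square_PiM) simp
  show ?e
    unfolding lebV_int_eq eq by (subst integral_mult_right_zero, subst integral_exp_square_PiM) auto
qed

text \<open>The integral equals \<open>sqrt (2 * pi) ^ vdim V\<close> times the maximum of the
  integrand over \<open>V\<close>, attained at the projection of \<open>Y\<close>. The value at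
  \<open>\<mu>\<close> is at most that maximum, and \<open>2 * pi \<ge> 1\<close>.\<close>

lemma lebV_int_exp_ge:
  assumes V: "fv.subspace V" "supported n V" and \<mu>: "\<mu> \<in> V"
  shows "lebV_int n V (\<lambda>\<gamma>. exp (- sqnorm n (\<lambda>i. Y i - \<gamma> i) / 2)) \<ge>
    exp (- sqnorm n (\<lambda>i. Y i - \<mu> i) / 2)"
proof -
  let ?S = "\<Sum>j<vdim V. (inner_n n Y (onb n V j))\<^sup>2"
  have "sqnorm n (\<lambda>i. Y i - \<mu> i) = sqnorm n Y - ?S +
      (\<Sum>j<vdim V. (inner_n n \<mu> (onb n V j) - inner_n n Y (onb n V j))\<^sup>2)"
    using sqnorm_diff_embed[OF onb_orthonormal[OF V], of Y "\<lambda>j. inner_n n \<mu> (onb n V j)"]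
    by (simp only: onb_embed[OF V \<mu>])
  hence "sqnorm n (\<lambda>i. Y i - \<mu> i) \<ge> sqnorm n Y - ?S"
    by (simp add: sum_nonneg)
  hence "exp (- sqnorm n (\<lambda>i. Y i - \<mu> i) / 2) \<le> 1 * exp (- (sqnorm n Y - ?S) / 2)"
    by simp
  also have "\<dots> \<le> sqrt (2 * pi) ^ vdim V * exp (- (sqnorm n Y - ?S) / 2)"
    using pi_gt3 by (intro mult_right_mono one_le_power) (auto simp: real_le_rsqrt)
  finally show ?thesis by (simp only: lebV_int_exp[OF V])
qed

lemma lebV_int_exp_nonneg: "0 \<le> lebV_int n V (\<lambda>\<gamma>. exp (- sqnorm n (\<lambda>i. Y i - \<gamma> i) / 2))"
  unfolding lebV_int_eq by (intro integral_nonneg_AE) auto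

lemma lebV_int_restrict_nonneg:
  "0 \<le> lebV_int n V (\<lambda>\<gamma>. (if P \<gamma> then 1 else 0) * exp (- sqnorm n (\<lambda>i. Y i - \<gamma> i) / 2))"
  unfolding lebV_int_eq by (intro integral_nonneg_AE) auto

text \<open>\<open>integral_mono'\<close> asks for integrability of the dominating function alone,
  since a non-integrable integrand has integral 0; this covers an arbitrary predicate
  \<open>P\<close>.\<close>

lemma lebV_int_restrict_le:
  assumes V: "fv.subspace V" "supported n V"
  shows "lebV_int n V (\<lambda>\<gamma>. (if P \<gamma> then 1 else 0) * exp (- sqnorm n (\<lambda>i. Y i - \<gamma> i) / 2)) \<le>
    lebV_int n V (\<lambda>\<gamma>. exp (- sqnorm n (\<lambda>i. Y i - \<gamma> i) / 2))"
  unfolding lebV_int_eq by (intro integral_mono' integrable_lebV_exp[OF V]) auto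

text \<open>The squared length of the projection of \<open>Y - \<mu>\<close> onto
  \<open>V + span \<mu>\<close>, for \<open>V\<close> a subspace of R^n; the last summand is 0 if
  \<open>\<mu>\<close> is in \<open>V\<close>.\<close>

definition proj_sq :: "nat \<Rightarrow> (nat \<Rightarrow> real) set \<Rightarrow> (nat \<Rightarrow> real) \<Rightarrow> (nat \<Rightarrow> real) \<Rightarrow> real" where
  "proj_sq n V \<mu> Y =
     (\<Sum>j<Suc (vdim V). (inner_n n (\<lambda>i. Y i - \<mu> i) (extend n (onb n V) (vdim V) \<mu> j))\<^sup>2)"

lemma lebV_int_far_le:
  assumes V: "fv.subspace V" "supported n V"
  shows "lebV_int n V (\<lambda>\<gamma>. (if sqnorm n (\<lambda>i. \<gamma> i - \<mu> i) > R then 1 else 0) *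
      exp (- sqnorm n (\<lambda>i. Y i - \<gamma> i) / 2)) \<le>
    exp (- sqnorm n (\<lambda>i. Y i - \<mu> i) / 2) * exp (proj_sq n V \<mu> Y - R / 8) * sqrt (8 * pi) ^ vdim V"
proof -
  let ?b = "onb n V" and ?t = "vdim V"
  let ?e = "\<lambda>i. Y i - \<mu> i" and ?h = "\<lambda>c i. embed n ?b ?t c i - \<mu> i"
  let ?K = "exp (- sqnorm n ?e / 2) * exp (proj_sq n V \<mu> Y - R / 8)"
  let ?q = "\<lambda>c. exp (- (\<Sum>j<?t. (c j - inner_n n \<mu> (?b j))\<^sup>2) / (2 * 2\<^sup>2))"
  have le: "(if sqnorm n (?h c) > R then 1 else 0) * exp (- sqnorm n (\<lambda>i. Y i - embed n ?b ?t c i) / 2) \<le> ?K * ?q c" for c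
  proof (cases "sqnorm n (?h c) > R")
    case True
    have "sqnorm n (\<lambda>i. Y i - embed n ?b ?t c i) = sqnorm n (\<lambda>i. ?e i - ?h c i)"
      by (simp add: sqnorm_def)
    also have "\<dots> = sqnorm n ?e - 2 * inner_n n ?e (?h c) + sqnorm n (?h c)"
      by (rule sqnorm_diff)
    finally have 1: "sqnorm n (\<lambda>i. Y i - embed n ?b ?t c i) =
        sqnorm n ?e - 2 * inner_n n ?e (?h c) + sqnorm n (?h c)" .
    have 2: "inner_n n ?e (?h c) \<le> proj_sq n V \<mu> Y + sqnorm n (?h c) / 4"
      unfolding proj_sq_def by (rule inner_n_embed_minus_le[OF onb_orthonormal[OF V]])
    have "sqnorm n (?h c) = sqnorm n (\<lambda>i. \<mu> i - embed n ?b ?t c i)"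
      by (simp add: sqnorm_def power2_commute)
    also have "\<dots> = sqnorm n (resid n ?b ?t \<mu>) + (\<Sum>j<?t. (c j - inner_n n \<mu> (?b j))\<^sup>2)"
      by (simp add: sqnorm_diff_embed[OF onb_orthonormal[OF V]] sqnorm_resid[OF onb_orthonormal[OF V]])
    finally have 3: "sqnorm n (?h c) \<ge> (\<Sum>j<?t. (c j - inner_n n \<mu> (?b j))\<^sup>2)"
      using sqnorm_nonneg[of n "resid n ?b ?t \<mu>"] by simp
    \<comment> \<open>After the bound on the inner product, \<open>- |h|^2 / 4\<close> remains. One
      half of it pays for \<open>- R / 8\<close>; the other half gives a Gaussian in
      \<open>c\<close> of variance 4, whose integral is the power of
      \<open>sqrt (8 * pi)\<close>.\<close>
    have "- sqnorm n (\<lambda>i. Y i - embed n ?b ?t c i) / 2 \<le>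
        - sqnorm n ?e / 2 + (proj_sq n V \<mu> Y - R / 8) + - (\<Sum>j<?t. (c j - inner_n n \<mu> (?b j))\<^sup>2) / (2 * 2\<^sup>2)"
      using 1 2 3 True by simp
    hence "exp (- sqnorm n (\<lambda>i. Y i - embed n ?b ?t c i) / 2) \<le>
        exp (- sqnorm n ?e / 2 + (proj_sq n V \<mu> Y - R / 8) + - (\<Sum>j<?t. (c j - inner_n n \<mu> (?b j))\<^sup>2) / (2 * 2\<^sup>2))"
      by simp
    thus ?thesis using True by (simp only: exp_add) simp
  qed simp
  have "lebV_int n V (\<lambda>\<gamma>. (if sqnorm n (\<lambda>i. \<gamma> i - \<mu> i) > R then 1 else 0) *
      exp (- sqnorm n (\<lambda>i. Y i - \<gamma> i) / 2)) \<le> (\<integral>c. ?K * ?q c \<partial>Pi\<^sub>M {..<?t} (\<lambda>_. lborel))"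
    unfolding lebV_int_eq
    by (intro integral_mono' integrable_mult_right integrable_exp_square_PiM le) auto
  also have "\<dots> = ?K * sqrt (8 * pi) ^ ?t"
    by (subst integral_mult_right_zero, subst integral_exp_square_PiM) (auto simp: mult_ac)
  finally show ?thesis .
qed

subsection \<open>The posterior\<close>

lemma pi_n_pos: "0 < pi_n d n p t"
  unfolding pi_n_def by (intro divide_pos_pos sum_pos) auto

lemma pi_n_ratio: "pi_n d n p t / pi_n d n p t0 = exp (- d * (real t - real t0) * ln (real p))"
proof -
  have "0 < (\<Sum>u\<le>n. exp (- d * real u * ln (real p)))" by (intro sum_pos) auto
  thus ?thesis by (simp add: pi_n_def exp_diff[symmetric] algebra_simps)
qed

text \<open>The prior mass factor of a single subspace, which turns the sum over dimensions in
  \<open>Xi_int\<close> into one sum over \<open>Vcoll\<close>.\<close>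

definition prior_weight :: "real \<Rightarrow> (nat \<Rightarrow> nat \<Rightarrow> nat \<Rightarrow> nat \<Rightarrow> real) \<Rightarrow> nat \<Rightarrow> nat \<Rightarrow> (nat \<Rightarrow> real) set \<Rightarrow> real" where
  "prior_weight d X n p V =
     pi_n d n p (vdim V) / real (card {W \<in> Vcoll X n p. vdim W = vdim V})"

lemma card_vdim_pos: "V \<in> Vcoll X n p \<Longrightarrow> 0 < card {W \<in> Vcoll X n p. vdim W = vdim V}"
  using finite_Vcoll[of X n p] by (auto simp: card_gt_0_iff)

lemma prior_weight_pos: "V \<in> Vcoll X n p \<Longrightarrow> 0 < prior_weight d X n p V"
  using card_vdim_pos[of V X n p] by (simp add: prior_weight_def pi_n_pos)

lemma sum_Vcoll:
  "(\<Sum>V\<in>Vcoll X n p. g V) = (\<Sum>t\<le>n. \<Sum>V\<in>{V \<in> Vcoll X n p. vdim V = t}. g V)"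
  using Vcoll_supported vdim_le by (intro sum.group[symmetric] finite_Vcoll) blast+

lemma Xi_int_eq: "Xi_int d X n p f = (\<Sum>V\<in>Vcoll X n p. prior_weight d X n p V * lebV_int n V f)"
  unfolding sum_Vcoll Xi_int_def by (intro sum.cong) (auto simp: prior_weight_def sum_distrib_left)

lemma le_root4:
  fixes x :: real
  assumes "0 \<le> x" "x \<le> 1"
  shows "x \<le> root 4 x"
proof -
  have "x ^ 4 \<le> x ^ 1" using assms by (intro power_decreasing) auto
  hence "root 4 (x ^ 4) \<le> root 4 x" by simp
  thus ?thesis using assms by (simp add: real_root_power_cancel)
qed

lemma root4_exp: "root 4 (exp x) = exp (x / 4)"
proof -
  have "exp x = exp (x / 4) ^ 4" by (simp add: exp_of_nat_mult[symmetric])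
  thus ?thesis by (metis exp_ge_zero real_root_power_cancel zero_less_numeral)
qed

lemma posterior_nonneg:
  "0 \<le> posterior d X n p P Y"
proof -
  have w: "0 \<le> prior_weight d X n p V" for V by (simp add: prior_weight_def pi_n_pos less_imp_le)
  show ?thesis
    unfolding posterior_def Xi_int_eq
    by (intro divide_nonneg_nonneg sum_nonneg mult_nonneg_nonneg w lebV_int_restrict_nonneg
         lebV_int_exp_nonneg)
qed

text \<open>The part of the bound that does not depend on \<open>Y\<close>. The fourth root matches
  \<open>exp (proj_sq n V \<mu> Y / 4)\<close>, whose expectation is finite.\<close>

definition subspace_bound :: "real \<Rightarrow> (nat \<Rightarrow> nat \<Rightarrow> nat \<Rightarrow> nat \<Rightarrow> real) \<Rightarrow> nat \<Rightarrow> nat \<Rightarrow> real \<Rightarrow> (nat \<Rightarrow> real) set \<Rightarrow> (nat \<Rightarrow> real) set \<Rightarrow> real" where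
  "subspace_bound d X n p R V0 V =
     root 4 (prior_weight d X n p V / prior_weight d X n p V0 * exp (- R / 8) * sqrt (8 * pi) ^ vdim V)"

text \<open>The posterior mass that \<open>V\<close> contributes is at most both \<open>1\<close> and its ratio to the single
  term \<open>V0\<close> of the normalising constant. That ratio contains \<open>exp (proj_sq n V \<mu> Y)\<close>, whose expectation is
  infinite; its fourth root is integrable and still dominates the mass, as \<open>x \<le> root 4 x\<close> on \<open>[0, 1]\<close>.\<close>

lemma posterior_le:
  assumes V0: "V0 \<in> Vcoll X n p" and \<mu>: "\<mu> \<in> V0"
  shows "posterior d X n p (\<lambda>\<gamma>. sqnorm n (\<lambda>i. \<gamma> i - \<mu> i) > R) Y \<le>
    (\<Sum>V\<in>Vcoll X n p. subspace_bound d X n p R V0 V * exp (proj_sq n V \<mu> Y / 4))"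
proof -
  let ?w = "prior_weight d X n p"
  let ?f = "\<lambda>\<gamma>. exp (- sqnorm n (\<lambda>i. Y i - \<gamma> i) / 2)"
  let ?g = "\<lambda>\<gamma>. (if sqnorm n (\<lambda>i. \<gamma> i - \<mu> i) > R then 1 else 0) * ?f \<gamma>"
  define D where "D = Xi_int d X n p ?f"
  have w: "0 < ?w V" if "V \<in> Vcoll X n p" for V using prior_weight_pos[OF that] .
  have Dge: "?w V * lebV_int n V ?f \<le> D" if "V \<in> Vcoll X n p" for V
    unfolding D_def Xi_int_eq
  proof (rule member_le_sum[OF that _ finite_Vcoll])
    fix W assume "W \<in> Vcoll X n p - {V}"
    thus "0 \<le> ?w W * lebV_int n W ?f"
      using w[of W] by (intro mult_nonneg_nonneg lebV_int_exp_nonneg) simp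
  qed
  have E0: "?w V0 * ?f \<mu> \<le> D"
    using Dge[OF V0] lebV_int_exp_ge[OF Vcoll_subspace[OF V0] Vcoll_supported[OF V0] \<mu>, of Y] w[OF V0]
    by (meson mult_left_mono less_imp_le order_trans)
  have E0pos: "0 < ?w V0 * ?f \<mu>" using w[OF V0] by simp
  hence Dpos: "0 < D" using E0 by linarith
  have "posterior d X n p (\<lambda>\<gamma>. sqnorm n (\<lambda>i. \<gamma> i - \<mu> i) > R) Y =
      (\<Sum>V\<in>Vcoll X n p. ?w V * lebV_int n V ?g / D)"
    unfolding posterior_def D_def[symmetric] Xi_int_eq[of d X n p ?g] by (simp add: sum_divide_distrib)
  also have "\<dots> \<le> (\<Sum>V\<in>Vcoll X n p. subspace_bound d X n p R V0 V * exp (proj_sq n V \<mu> Y / 4))"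
  proof (rule sum_mono)
    fix V assume V: "V \<in> Vcoll X n p"
    note VV = Vcoll_subspace[OF V] Vcoll_supported[OF V]
    let ?x = "?w V * lebV_int n V ?g / D"
    have g0: "0 \<le> ?w V * lebV_int n V ?g"
      using w[OF V] by (intro mult_nonneg_nonneg lebV_int_restrict_nonneg) simp
    have "?w V * lebV_int n V ?g \<le> ?w V * lebV_int n V ?f"
      using w[OF V] by (intro mult_left_mono lebV_int_restrict_le[OF VV]) simp
    hence "?w V * lebV_int n V ?g \<le> D" using Dge[OF V] by linarith
    hence x: "?x \<le> root 4 ?x"
      using g0 Dpos by (intro le_root4) auto
    have "?x \<le> ?w V * lebV_int n V ?g / (?w V0 * ?f \<mu>)"
      using g0 E0 E0pos by (intro divide_left_mono mult_pos_pos[OF Dpos]) auto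
    also have "\<dots> \<le> ?w V * (?f \<mu> * exp (proj_sq n V \<mu> Y - R / 8) * sqrt (8 * pi) ^ vdim V) / (?w V0 * ?f \<mu>)"
      using w[OF V] E0pos by (intro divide_right_mono mult_left_mono lebV_int_far_le[OF VV]) auto
    \<comment> \<open>The factor \<open>exp (- |Y - \<mu>|^2 / 2)\<close> occurs in the bound for
      \<open>V\<close> and in the term of \<open>V0\<close>, and cancels.\<close>
    also have "\<dots> = (?w V / ?w V0 * exp (- R / 8) * sqrt (8 * pi) ^ vdim V) * exp (proj_sq n V \<mu> Y)"
      using w[OF V0] exp_add[of "proj_sq n V \<mu> Y" "- R / 8"] by (simp add: mult_ac)
    finally have "root 4 ?x \<le>
        root 4 ((?w V / ?w V0 * exp (- R / 8) * sqrt (8 * pi) ^ vdim V) * exp (proj_sq n V \<mu> Y))"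
      by (intro real_root_le_mono) simp_all
    with x show "?x \<le> subspace_bound d X n p R V0 V * exp (proj_sq n V \<mu> Y / 4)"
      by (simp only: real_root_mult[of 4 _ "exp _"] root4_exp subspace_bound_def)
  qed
  finally show ?thesis .
qed

lemma subspace_bound_nonneg:
  "V0 \<in> Vcoll X n p \<Longrightarrow> V \<in> Vcoll X n p \<Longrightarrow> 0 \<le> subspace_bound d X n p R V0 V"
  using prior_weight_pos[of V X n p d] prior_weight_pos[of V0 X n p d]
  by (simp add: subspace_bound_def)

text \<open>Each subspace contributes \<open>vdim V + 1\<close> factors \<open>sqrt 2\<close>, the
  extra one from the direction that \<open>\<mu>\<close> adds to \<open>V\<close>.\<close>

lemma expected_posterior_le:
  assumes V0: "V0 \<in> Vcoll X n p" and \<mu>: "\<mu> \<in> V0"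
  shows "(\<integral>Y. posterior d X n p (\<lambda>\<gamma>. sqnorm n (\<lambda>i. \<gamma> i - \<mu> i) > R) Y \<partial>gauss_n n \<mu>) \<le>
    (\<Sum>V\<in>Vcoll X n p. subspace_bound d X n p R V0 V * sqrt 2 ^ Suc (vdim V))"
proof -
  let ?B = "subspace_bound d X n p R V0"
  have c: "sqnorm n (embed n (extend n (onb n V) (vdim V) \<mu>) (Suc (vdim V)) c) \<le> (\<Sum>j<Suc (vdim V). (c j)\<^sup>2)"
    if "V \<in> Vcoll X n p" for V c
    using that by (intro sqnorm_embed_extend_le onb_orthonormal Vcoll_subspace Vcoll_supported)
  have int: "integrable (gauss_n n \<mu>) (\<lambda>Y. exp (proj_sq n V \<mu> Y / 4))" if "V \<in> Vcoll X n p" for V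
    unfolding proj_sq_def by (rule integrable_gauss_exp_quadratic[OF c[OF that]])
  have "(\<integral>Y. posterior d X n p (\<lambda>\<gamma>. sqnorm n (\<lambda>i. \<gamma> i - \<mu> i) > R) Y \<partial>gauss_n n \<mu>) \<le>
      (\<integral>Y. (\<Sum>V\<in>Vcoll X n p. ?B V * exp (proj_sq n V \<mu> Y / 4)) \<partial>gauss_n n \<mu>)"
    \<comment> \<open>Integrability is established for the upper bound only, as
      \<open>integral_mono'\<close> requires.\<close>
    by (intro integral_mono' Bochner_Integration.integrable_sum integrable_mult_right int
        posterior_le[OF assms] sum_nonneg mult_nonneg_nonneg subspace_bound_nonneg[OF V0]) auto
  also have "\<dots> = (\<Sum>V\<in>Vcoll X n p. ?B V * (\<integral>Y. exp (proj_sq n V \<mu> Y / 4) \<partial>gauss_n n \<mu>))"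
    by (subst Bochner_Integration.integral_sum) (auto intro!: integrable_mult_right int)
  also have "\<dots> \<le> (\<Sum>V\<in>Vcoll X n p. ?B V * sqrt 2 ^ Suc (vdim V))"
    unfolding proj_sq_def
    by (intro sum_mono mult_left_mono subspace_bound_nonneg[OF V0] integral_gauss_exp_quadratic_le c)
  finally show ?thesis .
qed

section \<open>Summing the bounds over all subspaces\<close>

lemma exp_root_power:
  fixes L :: real
  shows "(exp (- L) * (2 * exp (- L / 4)) ^ t) ^ 4 = exp (- (4 + real t) * L) * 16 ^ t"
proof -
  have "(exp (- L) * (2 * exp (- L / 4)) ^ t) ^ 4 = exp (- L) ^ 4 * ((2 * exp (- L / 4)) ^ t) ^ 4"
    by (rule power_mult_distrib)
  also have "exp (- L) ^ 4 = exp (- 4 * L)"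
    using exp_of_nat_mult[of 4 "- L"] by simp
  also have "((2 * exp (- L / 4)) ^ t) ^ 4 = ((2 * exp (- L / 4)) ^ 4) ^ t"
    by (metis power_mult mult.commute)
  also have "(2 * exp (- L / 4)) ^ 4 = 16 * exp (- L)"
    using exp_of_nat_mult[of 4 "- L / 4"] by (subst power_mult_distrib) simp
  also have "(16 * exp (- L)) ^ t = 16 ^ t * exp (- real t * L)"
    using exp_of_nat_mult[of t "- L"] by (subst power_mult_distrib) simp
  also have "exp (- 4 * L) * (16 ^ t * exp (- real t * L)) = exp (- (4 + real t) * L) * 16 ^ t"
    using exp_add[of "- 4 * L" "- real t * L"] by (simp add: algebra_simps)
  finally show ?thesis .
qed

text \<open>All \<open>N\<close> subspaces of dimension \<open>t\<close> have the same bound, which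
  contains \<open>1 / N\<close> under the fourth root, so the sum costs only \<open>N ^ 3\<close>
  there. With \<open>N \<le> p ^ t\<close>, \<open>N0 \<le> p ^ t0\<close> and
  \<open>t0 = vdim V0\<close>, the root is taken of at most \<open>p powr (- (4 + t))\<close> times
  \<open>16 ^ t\<close>.\<close>

lemma sum_subspace_bound_le:
  assumes V0: "V0 \<in> Vcoll X n p" and d: "d \<ge> 4" and M: "M \<ge> 8 * (d + 5)" and p: "p \<ge> 1"
  shows "(\<Sum>V | V \<in> Vcoll X n p \<and> vdim V = t.
      subspace_bound d X n p (M * max (real (vdim V0)) 1 * ln (real p)) V0 V * sqrt 2 ^ Suc (vdim V))
    \<le> 2 * exp (- ln (real p)) * (4 * exp (- ln (real p) / 4)) ^ t"
proof (cases "{V \<in> Vcoll X n p. vdim V = t} = {}")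
  case True
  thus ?thesis by (simp only: sum.empty) simp
next
  case False
  let ?L = "ln (real p)" and ?m = "max (real (vdim V0)) 1"
  define N where "N = real (card {V \<in> Vcoll X n p. vdim V = t})"
  define N0 where "N0 = real (card {V \<in> Vcoll X n p. vdim V = vdim V0})"
  have N1: "0 < N" "0 < N0"
    using False card_vdim_pos[OF V0] finite_Vcoll[of X n p] by (auto simp: N_def N0_def card_gt_0_iff)
  have L: "0 \<le> ?L" using p by simp
  have card: "real (card {V \<in> Vcoll X n p. vdim V = s}) \<le> exp (real s * ?L)" for s
  proof -
    have "real (card {V \<in> Vcoll X n p. vdim V = s}) \<le> real (p ^ s)"
      using card_Vcoll_vdim_le of_nat_le_iff by blast
    also have "\<dots> = exp (real s * ?L)" using p by (subst exp_of_nat_mult) simp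
    finally show ?thesis .
  qed
  define A where "A = exp (- d * (real t - real (vdim V0)) * ?L) * exp (- (M * ?m * ?L) / 8)"
  define C where "C = exp (- ?L) * (2 * exp (- ?L / 4)) ^ t"
  have C4: "C ^ 4 = exp (- (4 + real t) * ?L) * 16 ^ t"
    unfolding C_def by (rule exp_root_power)
  have eq: "N * root 4 (A * (N0 / N) * sqrt (8 * pi) ^ t) = root 4 (N ^ 3 * A * N0 * sqrt (8 * pi) ^ t)"
  proof -
    have "N * root 4 (A * (N0 / N) * sqrt (8 * pi) ^ t) = root 4 (N ^ 4) * root 4 (A * (N0 / N) * sqrt (8 * pi) ^ t)"
      using N1 by (simp add: real_root_power_cancel)
    also have "\<dots> = root 4 (N ^ 4 * (A * (N0 / N) * sqrt (8 * pi) ^ t))"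
      by (simp only: real_root_mult)
    also have "N ^ 4 * (A * (N0 / N) * sqrt (8 * pi) ^ t) = N ^ 3 * A * N0 * sqrt (8 * pi) ^ t"
    proof -
      have "N ^ 4 = N ^ 3 * N" by (simp add: power_Suc2[symmetric])
      thus ?thesis using N1 by simp
    qed
    finally show ?thesis .
  qed
  have le: "N ^ 3 * A * N0 * sqrt (8 * pi) ^ t \<le> C ^ 4"
  proof -
    \<comment> \<open>The generous bound 16 is a fourth power, so its root is exactly 2.\<close>
    have "sqrt (8 * pi) \<le> 16"
      using pi_less_4 by (intro real_le_lsqrt) auto
    moreover have "N ^ 3 * A * N0 \<le> exp (real t * ?L) ^ 3 * A * exp (real (vdim V0) * ?L)"
      using card[of t] card[of "vdim V0"] N1
      by (intro mult_mono power_mono) (auto simp: N_def N0_def A_def)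
    moreover have "exp (real t * ?L) ^ 3 * A * exp (real (vdim V0) * ?L) \<le> exp (- (4 + real t) * ?L)"
    proof -
      have "exp (real t * ?L) ^ 3 * A * exp (real (vdim V0) * ?L) =
          exp ((3 * real t - d * (real t - real (vdim V0)) - M * ?m / 8 + real (vdim V0)) * ?L)"
        unfolding A_def by (simp add: exp_of_nat_mult[symmetric] exp_add[symmetric] algebra_simps)
      \<comment> \<open>The condition \<open>d \<ge> 4\<close> gives
        \<open>3 * t - d * t \<le> - t\<close>. The choice of \<open>M\<close> yields
        \<open>- (d + 5) * ?m\<close>, which absorbs \<open>(d + 1) * t0\<close> and leaves
        \<open>- 4 * ?m \<le> - 4\<close>.\<close>
      moreover have "3 * real t - d * (real t - real (vdim V0)) - M * ?m / 8 + real (vdim V0) \<le> - (4 + real t)"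
      proof -
        have "8 * (d + 5) * ?m \<le> M * ?m" using M by (intro mult_right_mono) auto
        moreover have "(d + 1) * real (vdim V0) \<le> (d + 1) * ?m" using d by (intro mult_left_mono) auto
        moreover have "(d - 4) * real t \<ge> 0" using d by simp
        moreover have "?m \<ge> 1" by simp
        ultimately show ?thesis by (simp add: algebra_simps)
      qed
      ultimately show ?thesis using L by (simp add: mult_right_mono)
    qed
    ultimately have "(N ^ 3 * A * N0) * sqrt (8 * pi) ^ t \<le> exp (- (4 + real t) * ?L) * 16 ^ t"
      by (intro mult_mono power_mono) auto
    thus ?thesis by (simp only: C4)
  qed
  have term_eq: "subspace_bound d X n p (M * ?m * ?L) V0 V = root 4 (A * (N0 / N) * sqrt (8 * pi) ^ t)"
    if "vdim V = t" for V
  proof -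
    have "prior_weight d X n p V / prior_weight d X n p V0 =
        pi_n d n p t / pi_n d n p (vdim V0) * (N0 / N)"
      using that by (simp add: prior_weight_def N_def N0_def)
    thus ?thesis
      using that by (simp add: subspace_bound_def pi_n_ratio A_def mult_ac)
  qed
  have "(\<Sum>V | V \<in> Vcoll X n p \<and> vdim V = t. subspace_bound d X n p (M * ?m * ?L) V0 V * sqrt 2 ^ Suc (vdim V))
      = N * root 4 (A * (N0 / N) * sqrt (8 * pi) ^ t) * sqrt 2 ^ Suc t"
    by (simp add: term_eq N_def)
  also have "\<dots> = root 4 (N ^ 3 * A * N0 * sqrt (8 * pi) ^ t) * sqrt 2 ^ Suc t"
    by (simp only: eq)
  also have "\<dots> \<le> root 4 (C ^ 4) * 2 ^ Suc t"
    using le N1 by (intro mult_mono power_mono) (auto simp: real_sqrt_le_iff real_le_lsqrt A_def)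
  also have "root 4 (C ^ 4) = C"
    by (rule real_root_power_cancel) (auto simp: C_def)
  also have "C * 2 ^ Suc t = 2 * exp (- ?L) * (4 * exp (- ?L / 4)) ^ t"
  proof -
    have "(4::real) ^ t = 2 ^ t * 2 ^ t" by (simp add: power_mult_distrib[symmetric])
    thus ?thesis by (simp add: C_def power_mult_distrib mult_ac)
  qed
  finally show ?thesis .
qed

text \<open>Since \<open>4096 = 8 ^ 4\<close>, the ratio \<open>4 * p powr (- 1 / 4)\<close> of the
  geometric series is at most \<open>1 / 2\<close>. The result depends neither on \<open>n\<close>
  nor on \<open>X\<close> nor on \<open>\<mu>\<close>.\<close>

lemma expected_posterior_le_inverse:
  assumes V0: "V0 \<in> Vcoll X n p" and \<mu>: "\<mu> \<in> V0"
    and d: "d \<ge> 4" and M: "M \<ge> 8 * (d + 5)" and p: "p \<ge> 4096"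
  shows "(\<integral>Y. posterior d X n p (\<lambda>\<gamma>. sqnorm n (\<lambda>i. \<gamma> i - \<mu> i) >
      M * max (real (vdim V0)) 1 * ln (real p)) Y \<partial>gauss_n n \<mu>) \<le> 4 / real p"
proof -
  let ?L = "ln (real p)"
  have "ln (8 ^ 4 :: real) \<le> ?L" using p by simp
  hence "ln 8 \<le> ?L / 4" by (simp only: ln_realpow)
  hence "exp (ln 8) \<le> exp (?L / 4)" by (simp only: exp_le_cancel_iff)
  hence q: "4 * exp (- ?L / 4) \<le> 1 / 2" by (simp add: exp_minus field_simps)
  have eL: "exp (- ?L) = 1 / real p" using p by (simp add: exp_minus field_simps)
  have "(\<integral>Y. posterior d X n p (\<lambda>\<gamma>. sqnorm n (\<lambda>i. \<gamma> i - \<mu> i) >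
      M * max (real (vdim V0)) 1 * ?L) Y \<partial>gauss_n n \<mu>) \<le> 
      (\<Sum>t\<le>n. \<Sum>V | V \<in> Vcoll X n p \<and> vdim V = t.
        subspace_bound d X n p (M * max (real (vdim V0)) 1 * ?L) V0 V * sqrt 2 ^ Suc (vdim V))"
    using expected_posterior_le[OF V0 \<mu>] unfolding sum_Vcoll .
  also have "\<dots> \<le> (\<Sum>t\<le>n. 2 * exp (- ?L) * (4 * exp (- ?L / 4)) ^ t)"
    using p by (intro sum_mono sum_subspace_bound_le V0 d M) simp
  also have "\<dots> \<le> (\<Sum>t\<le>n. 2 / real p * (1 / 2) ^ t)"
    unfolding eL using q by (intro sum_mono mult_mono power_mono) auto
  also have "\<dots> = 2 / real p * (\<Sum>t\<le>n. (1 / 2) ^ t)" by (simp only: sum_distrib_left)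
  also have "\<dots> \<le> 2 / real p * 2"
  proof (rule mult_left_mono)
    have "(\<Sum>t\<le>n. (1 / 2 :: real) ^ t) = 2 - (1 / 2) ^ n"
      by (induction n) (auto simp: field_simps)
    thus "(\<Sum>t\<le>n. (1 / 2 :: real) ^ t) \<le> 2" by simp
  qed simp
  finally show ?thesis by simp
qed

section \<open>The uniform limit\<close>

theorem theorem9:
  fixes d :: real and X :: "nat \<Rightarrow> nat \<Rightarrow> nat \<Rightarrow> nat \<Rightarrow> real"
  assumes "d \<ge> 4"
  shows "\<exists>M0. \<forall>M\<ge>M0.
    ((\<lambda>(n, p). SUP \<beta>0 \<in> {\<beta>. \<forall>j\<ge>p. \<beta> j = 0}.
        \<integral>Y. posterior d X n p
              (\<lambda>\<gamma>. sqnorm n (\<lambda>i. \<gamma> i - Xmul X n p \<beta>0 i) >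
                    M * max (real (vdim (colspace X n p {j. \<beta>0 j \<noteq> 0}))) 1 * ln (real p)) Y
           \<partial>gauss_n n (Xmul X n p \<beta>0))
     \<longlongrightarrow> 0) (sequentially \<times>\<^sub>F sequentially)"
proof (intro exI[of _ "8 * (d + 5)"] allI impI)
  fix M :: real assume M: "8 * (d + 5) \<le> M"
  let ?E = "\<lambda>n p \<beta>0. \<integral>Y. posterior d X n p
              (\<lambda>\<gamma>. sqnorm n (\<lambda>i. \<gamma> i - Xmul X n p \<beta>0 i) >
                    M * max (real (vdim (colspace X n p {j. \<beta>0 j \<noteq> 0}))) 1 * ln (real p)) Y
           \<partial>gauss_n n (Xmul X n p \<beta>0)"
  let ?S = "\<lambda>(n, p). SUP \<beta>0 \<in> {\<beta>. \<forall>j\<ge>p. \<beta> j = 0}. ?E n p \<beta>0"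
  have le: "?E n p \<beta>0 \<le> 4 / real p" if "p \<ge> 4096" "\<forall>j\<ge>p. \<beta>0 j = 0" for n p \<beta>0
  proof (rule expected_posterior_le_inverse[OF _ _ assms M that(1)])
    show "colspace X n p {j. \<beta>0 j \<noteq> 0} \<in> Vcoll X n p"
      using that(2) unfolding Vcoll_def by (auto simp: not_le[symmetric] intro!: exI[of _ "{j. \<beta>0 j \<noteq> 0}"])
    show "Xmul X n p \<beta>0 \<in> colspace X n p {j. \<beta>0 j \<noteq> 0}"
      using that(2) by (auto simp: colspace_def)
  qed
  have S: "0 \<le> ?S (n, p)" "?S (n, p) \<le> 4 / real p" if p: "p \<ge> 4096" for n p
  proof -
    have "0 \<le> ?E n p (\<lambda>_. 0)" by (intro integral_nonneg_AE AE_I2 posterior_nonneg)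
    also have "\<dots> \<le> ?S (n, p)"
      unfolding prod.case
      \<comment> \<open>The real supremum is informative only for a set bounded above; the uniform
        bound \<open>4 / real p\<close> provides this. The vector \<open>\<beta>0 = 0\<close> shows
        that the supremum is nonnegative.\<close>
      by (rule cSUP_upper) (auto intro!: bdd_aboveI2[of _ _ "4 / real p"] le[OF p])
    finally show "0 \<le> ?S (n, p)" .
    show "?S (n, p) \<le> 4 / real p"
      unfolding prod.case by (rule cSUP_least) (auto intro!: le[OF p])
  qed
  \<comment> \<open>The bound involves \<open>p\<close> alone, so the joint limit requires only that
    the second coordinate grows, with no relation between \<open>n\<close> and
    \<open>p\<close>.\<close>
  have ev: "\<forall>\<^sub>F x in sequentially \<times>\<^sub>F sequentially. snd x \<ge> (4096 :: nat)"
    using filterlim_snd[of sequentially sequentially] by (simp add: filterlim_at_top)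
  show "(?S \<longlongrightarrow> 0) (sequentially \<times>\<^sub>F sequentially)"
  proof (rule tendsto_sandwich[where f = "\<lambda>_. 0" and h = "\<lambda>x. 4 / real (snd x)"])
    show "\<forall>\<^sub>F x in sequentially \<times>\<^sub>F sequentially. 0 \<le> ?S x"
    proof (rule eventually_mono[OF ev])
      fix x :: "nat \<times> nat" assume "4096 \<le> snd x"
      thus "0 \<le> ?S x" using S(1)[of "snd x" "fst x"] by (simp only: prod.collapse)
    qed
    show "\<forall>\<^sub>F x in sequentially \<times>\<^sub>F sequentially. ?S x \<le> 4 / real (snd x)"
    proof (rule eventually_mono[OF ev])
      fix x :: "nat \<times> nat" assume "4096 \<le> snd x"
      thus "?S x \<le> 4 / real (snd x)" using S(2)[of "snd x" "fst x"] by (simp only: prod.collapse)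
    qed
    show "((\<lambda>x. 4 / real (snd x)) \<longlongrightarrow> 0) (sequentially \<times>\<^sub>F sequentially)"
      by (rule filterlim_compose[OF lim_const_over_n filterlim_snd])
  qed simp
qed

end
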